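(* For positive integers $1 \leq r < s \leq t$ we have $D_{r,t}(n) \geq D_{s,t}(n)$ for all sufficiently large $n$. In particular, for every $2 \leq t \leq 10$ and all $1 \leq r < s \leq t$, the inequality $D_{r,t}(n) \geq D_{s,t}(n)$ holds for all integers $n > 8$.
   Context: For integers $1 \leq r \leq t$ and $n \geq 1$, $D_{r,t}(n)$ is the total number of parts congruent to $r$ modulo $t$ among all partitions of $n$ into pairwise distinct parts, i.e. $D_{r,t}(n) := \sum_{\lambda} \#\{\lambda_j : \lambda_j \equiv r \pmod t\}$, the sum being over all partitions $\lambda=(\lambda_1,\lambda_2,\dots)$ of $n$ into distinct parts. *)

theory Defs
  imports Complex_Main "HOL-Number_Theory.Cong"
begin

definition partitions :: "nat \<Rightarrow> nat list set" where
  "partitions n = {ps. sorted_wrt (\<ge>) ps \<and> (\<forall>p \<in> set ps. p > 0) \<and> sum_list ps = n}"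

definition distinct_partitions :: "nat \<Rightarrow> nat list set" where
  "distinct_partitions n = {ps \<in> partitions n. distinct ps}"

definition D :: "nat \<Rightarrow> nat \<Rightarrow> nat \<Rightarrow> nat" where
  "D r t n = (\<Sum>ps \<in> distinct_partitions n. card {p \<in> set ps. [p = r] (mod t)})"

(* The index set of the sum in D is finite, so the sum is not the default value 0. *)
lemma finite_distinct_partitions: "finite (distinct_partitions n)"
proof (rule finite_subset)
  show "distinct_partitions n \<subseteq> {xs. set xs \<subseteq> {..n} \<and> distinct xs}"
    by (auto simp: distinct_partitions_def partitions_def member_le_sum_list)
  show "finite {xs. set xs \<subseteq> {..n} \<and> distinct xs}"
    by (rule finite_subset_distinct) simp
qed

end

theory Submission
  imports Defs "HOL-Computational_Algebra.Formal_Power_Series"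
begin

text \<open>For \<open>n > 8\<close> the number of partitions of \<open>n\<close> into distinct parts that contain the part \<open>m\<close> is
  decreasing in \<open>m \<ge> 1\<close>; the claim follows by comparing the parts \<open>r + k t\<close> and \<open>s + k t\<close> for each \<open>k\<close>.
  The difference between the counts for \<open>m\<close> and \<open>m + 1\<close> is a coefficient of
  \<open>(1 - X) * (\<Prod>k\<noteq>m,m+1. 1 + X ^ k)\<close>. If neither \<open>m\<close> nor \<open>m + 1\<close> is a power of two, the factors with \<open>k\<close> a
  power of two cancel \<open>1 - X\<close>. If one of them is \<open>2 ^ a \<ge> 8\<close>, the powers below \<open>2 ^ a\<close> turn \<open>1 - X\<close>
  into \<open>1 - X ^ (x + y) = (1 - X ^ x) + X ^ x * (1 - X ^ y)\<close> with \<open>x = 3\<close>, \<open>y = 2 ^ a - 3\<close> odd and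
  distinct, and the factors with \<open>k = 2 ^ j * x\<close> and \<open>k = 2 ^ j * y\<close> cancel \<open>1 - X ^ x\<close> and \<open>1 - X ^ y\<close>.
  The remaining cases \<open>m \<le> 4\<close> reduce to polynomials whose only negative coefficients concern
  \<open>n \<le> 8\<close>.\<close>

section \<open>Generating functions for sets of distinct parts\<close>

definition part_count :: "nat \<Rightarrow> nat \<Rightarrow> nat" where
  "part_count m n = card {S. finite S \<and> 0 \<notin> S \<and> \<Sum>S = n \<and> m \<in> S}"

definition distinct_gf :: "nat set \<Rightarrow> int fps" where
  "distinct_gf A = (\<Prod>k\<in>A. 1 + fps_X ^ k)"

definition doubling_chain :: "nat \<Rightarrow> nat \<Rightarrow> nat set" where
  "doubling_chain x J = (\<lambda>j. x * 2 ^ j) ` {..<J}"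

text \<open>Truncating at degree \<open>n\<close> keeps all products finite: a finite doubling chain
  leaves a negative coefficient, but one that can be pushed beyond \<open>n\<close>.\<close>

definition nonneg_upto :: "nat \<Rightarrow> int fps \<Rightarrow> bool" where
  "nonneg_upto n f \<longleftrightarrow> (\<forall>i\<le>n. 0 \<le> fps_nth f i)"

lemma nonneg_upto_add: "nonneg_upto n f \<Longrightarrow> nonneg_upto n g \<Longrightarrow> nonneg_upto n (f + g)"
  by (simp add: nonneg_upto_def)

lemma nonneg_upto_mult: "nonneg_upto n f \<Longrightarrow> nonneg_upto n g \<Longrightarrow> nonneg_upto n (f * g)"
  by (auto simp: nonneg_upto_def fps_mult_nth intro!: sum_nonneg mult_nonneg_nonneg)

lemma nonneg_upto_X_power: "nonneg_upto n (fps_X ^ k)"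
  by (simp add: nonneg_upto_def)

lemma nonneg_upto_one: "nonneg_upto n 1"
  by (simp add: nonneg_upto_def)

lemma nonneg_upto_one_minus_X_power: "n < k \<Longrightarrow> nonneg_upto n (1 - fps_X ^ k)"
  by (auto simp: nonneg_upto_def)

lemma nonneg_upto_distinct_gf: "nonneg_upto n (distinct_gf A)"
  unfolding distinct_gf_def
  by (induction A rule: infinite_finite_induct)
     (auto intro!: nonneg_upto_mult nonneg_upto_add nonneg_upto_X_power nonneg_upto_one)

lemma distinct_gf_Un:
  "finite A \<Longrightarrow> finite B \<Longrightarrow> A \<inter> B = {} \<Longrightarrow> distinct_gf (A \<union> B) = distinct_gf A * distinct_gf B"
  by (simp add: distinct_gf_def prod.union_disjoint)

lemma distinct_gf_insert:
  "finite A \<Longrightarrow> k \<notin> A \<Longrightarrow> distinct_gf (insert k A) = (1 + fps_X ^ k) * distinct_gf A"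
  by (simp add: distinct_gf_def)

lemma distinct_gf_remove:
  "finite A \<Longrightarrow> k \<in> A \<Longrightarrow> distinct_gf A = (1 + fps_X ^ k) * distinct_gf (A - {k})"
  by (simp add: distinct_gf_def prod.remove)

text \<open>Expanding the product means choosing \<open>fps_X ^ k\<close> or 1 from each factor, so
  its terms correspond to the subsets of \<open>A\<close>.\<close>

lemma distinct_gf_nth:
  assumes "finite A"
  shows "fps_nth (distinct_gf A) n = int (card {S \<in> Pow A. \<Sum>S = n})"
proof -
  have "distinct_gf A = (\<Prod>k\<in>A. fps_X ^ k + 1)"
    by (simp add: distinct_gf_def add.commute)
  also have "\<dots> = (\<Sum>S\<in>Pow A. fps_X ^ (\<Sum>S))"
    by (simp add: prod_add[OF assms] power_sum)
  finally have "fps_nth (distinct_gf A) n = (\<Sum>S\<in>Pow A. if n = \<Sum>S then 1 else 0)"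
    by (simp add: fps_sum_nth)
  also have "\<dots> = int (card {S \<in> Pow A. \<Sum>S = n})"
    using assms by (simp add: sum.If_cases Int_def eq_commute)
  finally show ?thesis .
qed

text \<open>Parts above \<open>n\<close> cannot occur in a sum \<open>n\<close>, so \<open>A\<close>
  may be any finite set of positive numbers that contains \<open>m\<close> and
  \<open>{1..n}\<close>. This freedom lets \<open>A\<close> include whole doubling chains
  later.\<close>

lemma part_count_eq_coeff:
  assumes "finite A" "0 \<notin> A" "{1..n} \<subseteq> A" "m \<in> A"
  shows "int (part_count m n) = fps_nth (fps_X ^ m * distinct_gf (A - {m})) n"
proof (cases "n < m")
  case True
  have "{S. finite S \<and> 0 \<notin> S \<and> \<Sum>S = n \<and> m \<in> S} = {}"
    using True member_le_sum[of m _ "\<lambda>x::nat. x"] by force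
  then have "part_count m n = 0"
    unfolding part_count_def by (simp only: card.empty)
  then show ?thesis
    using True by (simp add: fps_X_power_mult_nth)
next
  case False
  have "bij_betw (insert m) {S \<in> Pow (A - {m}). \<Sum>S = n - m}
          {S. finite S \<and> 0 \<notin> S \<and> \<Sum>S = n \<and> m \<in> S}"
  proof (rule bij_betwI[where g = "\<lambda>S. S - {m}"])
    show "insert m \<in> {S \<in> Pow (A - {m}). \<Sum>S = n - m} \<rightarrow>
            {S. finite S \<and> 0 \<notin> S \<and> \<Sum>S = n \<and> m \<in> S}"
    proof
      fix S assume S: "S \<in> {S \<in> Pow (A - {m}). \<Sum>S = n - m}"
      then have "finite S" "m \<notin> S"
        using assms(1) finite_subset by auto
      moreover have "m \<noteq> 0"
        using assms(2,4) by metis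
      ultimately show "insert m S \<in> {S. finite S \<and> 0 \<notin> S \<and> \<Sum>S = n \<and> m \<in> S}"
        using S False assms by (auto intro: gr0I)
    qed
    show "(\<lambda>S. S - {m}) \<in> {S. finite S \<and> 0 \<notin> S \<and> \<Sum>S = n \<and> m \<in> S} \<rightarrow>
            {S \<in> Pow (A - {m}). \<Sum>S = n - m}"
    proof
      fix S assume S: "S \<in> {S. finite S \<and> 0 \<notin> S \<and> \<Sum>S = n \<and> m \<in> S}"
      have "x \<in> A" if "x \<in> S" for x
      proof -
        have "x \<le> n" "x \<noteq> 0"
          using S that member_le_sum[of x S "\<lambda>x. x"] by (auto intro: gr0I)
        then show ?thesis
          using assms(3) by auto
      qed
      then show "S - {m} \<in> {S \<in> Pow (A - {m}). \<Sum>S = n - m}"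
        using S by (auto simp: sum_diff1_nat)
    qed
  qed auto
  then show ?thesis
    using False assms(1)
    by (simp add: part_count_def fps_X_power_mult_nth distinct_gf_nth bij_betw_same_card)
qed

text \<open>Partitions containing both \<open>m\<close> and \<open>Suc m\<close> are counted on both
  sides and cancel; what remains is \<open>fps_X ^ m - fps_X ^ Suc m\<close> times the product over
  the other parts.\<close>

lemma part_count_diff:
  assumes "finite A" "0 \<notin> A" "{1..n} \<subseteq> A" "m \<in> A" "Suc m \<in> A"
  shows "int (part_count m n) - int (part_count (Suc m) n) =
    (if n < m then 0 else fps_nth ((1 - fps_X) * distinct_gf (A - {m, Suc m})) (n - m))"
proof -
  let ?Q = "distinct_gf (A - {m, Suc m})"
  have 1: "distinct_gf (A - {m}) = (1 + fps_X ^ Suc m) * ?Q"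
    using distinct_gf_remove[of "A - {m}" "Suc m"] assms by (simp add: Diff_insert2[symmetric] insert_commute)
  have 2: "distinct_gf (A - {Suc m}) = (1 + fps_X ^ m) * ?Q"
    using distinct_gf_remove[of "A - {Suc m}" m] assms by (simp add: Diff_insert2[symmetric] insert_commute)
  have "int (part_count m n) - int (part_count (Suc m) n) =
      fps_nth (fps_X ^ m * ((1 + fps_X ^ Suc m) * ?Q) - fps_X ^ Suc m * ((1 + fps_X ^ m) * ?Q)) n"
    using assms by (simp add: part_count_eq_coeff[of A] 1 2 del: power_Suc)
  also have "fps_X ^ m * ((1 + fps_X ^ Suc m) * ?Q) - fps_X ^ Suc m * ((1 + fps_X ^ m) * ?Q)
      = fps_X ^ m * ((1 - fps_X) * ?Q)"
    by (simp add: algebra_simps)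
  finally show ?thesis
    by (simp add: fps_X_power_mult_nth)
qed

section \<open>Doubling chains and the cancellation of negative terms\<close>

lemma finite_doubling_chain [simp]: "finite (doubling_chain x J)"
  by (simp add: doubling_chain_def)

lemma zero_notin_doubling_chain: "0 < x \<Longrightarrow> 0 \<notin> doubling_chain x J"
  by (auto simp: doubling_chain_def)

text \<open>Iterating \<open>(1 - z) * (1 + z) = 1 - z ^ 2\<close> collapses the product; this is
  the uniqueness of binary expansions in terms of series.\<close>

lemma distinct_gf_doubling_chain:
  assumes "0 < x"
  shows "(1 - fps_X ^ x) * distinct_gf (doubling_chain x J) = 1 - fps_X ^ (x * 2 ^ J)"
proof -
  have "inj_on (\<lambda>j. x * 2 ^ j) {..<J}"
    using assms by (auto simp: inj_on_def)
  then have "distinct_gf (doubling_chain x J) = (\<Prod>j<J. 1 + fps_X ^ (x * 2 ^ j))"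
    by (simp add: distinct_gf_def doubling_chain_def prod.reindex)
  moreover have "(1 - fps_X ^ x :: int fps) * (\<Prod>j<J. 1 + fps_X ^ (x * 2 ^ j)) = 1 - fps_X ^ (x * 2 ^ J)"
  proof (induction J)
    case (Suc J)
    have "(1 - fps_X ^ x :: int fps) * (\<Prod>j<Suc J. 1 + fps_X ^ (x * 2 ^ j)) =
        (1 - fps_X ^ (x * 2 ^ J)) * (1 + fps_X ^ (x * 2 ^ J))"
      by (simp add: Suc.IH[symmetric] mult.assoc)
    also have "\<dots> = 1 - fps_X ^ (x * 2 ^ J + x * 2 ^ J)"
      by (simp add: algebra_simps power_add)
    finally show ?case
      by (simp add: mult_2_right algebra_simps mult_2)
  qed simp
  ultimately show ?thesis by simp
qed

lemma odd_times_power2_eq: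
  fixes x y :: nat
  assumes "odd x" "odd y" "x * 2 ^ i = y * 2 ^ j"
  shows "x = y"
  using assms(3)
proof (induction i arbitrary: j)
  case 0
  then show ?case using assms by (cases j) auto
next
  case (Suc i)
  then show ?case using assms by (cases j) auto
qed

lemma odd_in_doubling_chain: "odd y \<Longrightarrow> y \<in> doubling_chain x J \<Longrightarrow> y = x"
  by (auto simp: doubling_chain_def)

lemma disjoint_doubling_chains:
  assumes "odd x" "odd y" "x \<noteq> y"
  shows "doubling_chain x I \<inter> doubling_chain y J = {}"
  using odd_times_power2_eq[OF assms(1,2)] assms(3) by (auto simp: doubling_chain_def)

lemma nonneg_upto_doubling_chain:
  assumes "0 < x" "n < 2 ^ J"
  shows "nonneg_upto n ((1 - fps_X ^ x) * distinct_gf (doubling_chain x J))"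
proof -
  have "2 ^ J \<le> x * 2 ^ J" using assms(1) by simp
  then have "n < x * 2 ^ J" using assms(2) by linarith
  then show ?thesis
    using assms(1) by (simp add: distinct_gf_doubling_chain nonneg_upto_one_minus_X_power)
qed

lemma nonneg_upto_two_chains:
  assumes "0 < x" "0 < y" "n < 2 ^ J"
  shows "nonneg_upto n ((1 - fps_X ^ (x + y)) *
    (distinct_gf (doubling_chain x J) * distinct_gf (doubling_chain y J)))"
proof -
  let ?x = "distinct_gf (doubling_chain x J)" and ?y = "distinct_gf (doubling_chain y J)"
  \<comment> \<open>In each summand one chain absorbs its own negative factor, and the other chain
    is only a nonnegative multiplier.\<close>
  have "(1 - fps_X ^ (x + y)) * (?x * ?y) =
      ((1 - fps_X ^ x) * ?x) * ?y + fps_X ^ x * ?x * ((1 - fps_X ^ y) * ?y)"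
    by (simp add: algebra_simps power_add)
  moreover have "nonneg_upto n (((1 - fps_X ^ x) * ?x) * ?y)"
    using assms by (intro nonneg_upto_mult nonneg_upto_doubling_chain nonneg_upto_distinct_gf)
  moreover have "nonneg_upto n (fps_X ^ x * ?x * ((1 - fps_X ^ y) * ?y))"
    using assms
    by (intro nonneg_upto_mult[OF nonneg_upto_mult] nonneg_upto_X_power nonneg_upto_distinct_gf
        nonneg_upto_doubling_chain)
  ultimately show ?thesis
    by (simp only: nonneg_upto_add)
qed

section \<open>Comparing the consecutive parts \<open>m\<close> and \<open>Suc m\<close>\<close>

lemma part_count_Suc_le_not_power2:
  assumes "0 < m" "\<And>j. m \<noteq> 2 ^ j" "\<And>j. Suc m \<noteq> 2 ^ j"
  shows "part_count (Suc m) n \<le> part_count m n"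
proof -
  \<comment> \<open>Length \<open>n\<close> is enough because \<open>n < 2 ^ n\<close>.\<close>
  let ?C = "doubling_chain 1 n"
  define A where "A = {1..n} \<union> {m, Suc m} \<union> ?C"
  have C: "m \<notin> ?C" "Suc m \<notin> ?C"
    using assms by (auto simp: doubling_chain_def)
  have A: "A - {m, Suc m} = ?C \<union> (A - {m, Suc m} - ?C)"
    using C by (auto simp: A_def)
  have "distinct_gf (A - {m, Suc m}) = distinct_gf ?C * distinct_gf (A - {m, Suc m} - ?C)"
    by (subst A, rule distinct_gf_Un) (auto simp: A_def)
  then have "nonneg_upto n ((1 - fps_X) * distinct_gf (A - {m, Suc m}))"
    using nonneg_upto_mult[OF nonneg_upto_doubling_chain[of 1 n n] nonneg_upto_distinct_gf]
    by (simp add: mult.assoc)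
  then have "int (part_count m n) - int (part_count (Suc m) n) \<ge> 0"
    using assms(1) zero_notin_doubling_chain[of 1 n]
    by (subst part_count_diff[of A]) (auto simp: A_def nonneg_upto_def)
  then show ?thesis by simp
qed

lemma part_count_Suc_le_power2:
  assumes "8 \<le> (2::nat) ^ a" "m = 2 ^ a \<or> Suc m = 2 ^ a"
  shows "part_count (Suc m) n \<le> part_count m n"
proof -
  \<comment> \<open>From \<open>8 \<le> 2 ^ a\<close> follows \<open>y \<ge> 5\<close>, so 1, 3 and
    \<open>y\<close> are distinct odd numbers and start disjoint chains.\<close>
  define y :: nat where "y = 2 ^ a - 3"
  have a: "a > 0" using assms(1) by (cases a) auto
  have y: "odd y" "y \<noteq> 1" "y \<noteq> 3" "2 ^ a = 3 + y" "0 < y"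
    using assms(1) a by (auto simp: y_def)
  \<comment> \<open>The chain of 1 stops at \<open>2 ^ (a - 1)\<close>, just before the excluded
    part \<open>2 ^ a\<close>.\<close>
  let ?C = "doubling_chain 1 a \<union> (doubling_chain 3 n \<union> doubling_chain y n)"
  have mem: "k \<notin> ?C" if "k = m \<or> k = Suc m" for k
  proof (cases "k = 2 ^ a")
    case True
    then show ?thesis
      using odd_times_power2_eq[of 1 3 a] odd_times_power2_eq[of 1 y a] y
      by (auto simp: doubling_chain_def)
  next
    case False
    \<comment> \<open>The neighbours of \<open>2 ^ a\<close> are odd, so they could only be the
      first element of a chain.\<close>
    then have "k = 2 ^ a + 1 \<or> Suc k = 2 ^ a"
      using assms(2) that by auto
    moreover have "even ((2::nat) ^ a)"
      using a by simp
    ultimately have "odd k" "k \<noteq> 1" "k \<noteq> 3" "k \<noteq> y"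
      using assms(1) y(4) by presburger+
    then show ?thesis
      using odd_in_doubling_chain by blast
  qed
  define A where "A = {1..n} \<union> {m, Suc m} \<union> ?C"
  have A: "A - {m, Suc m} = ?C \<union> (A - {m, Suc m} - ?C)"
    using mem by (auto simp: A_def)
  have "distinct_gf (A - {m, Suc m}) = distinct_gf ?C * distinct_gf (A - {m, Suc m} - ?C)"
    by (subst A, rule distinct_gf_Un) (auto simp: A_def)
  also have "distinct_gf ?C = distinct_gf (doubling_chain 1 a) *
      (distinct_gf (doubling_chain 3 n) * distinct_gf (doubling_chain y n))"
    using disjoint_doubling_chains[of 3 y] disjoint_doubling_chains[of 1] y
    by (simp add: distinct_gf_Un Int_Un_distrib)
  finally have "(1 - fps_X) * distinct_gf (A - {m, Suc m}) =
      (1 - fps_X) * distinct_gf (doubling_chain 1 a) *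
      (distinct_gf (doubling_chain 3 n) * distinct_gf (doubling_chain y n)) *
      distinct_gf (A - {m, Suc m} - ?C)"
    by (simp add: mult.assoc)
  also have "(1 - fps_X) * distinct_gf (doubling_chain 1 a) = 1 - fps_X ^ (3 + y)"
    using distinct_gf_doubling_chain[of 1 a] y by simp
  finally have "nonneg_upto n ((1 - fps_X) * distinct_gf (A - {m, Suc m}))"
    using nonneg_upto_mult[OF nonneg_upto_two_chains[of 3 y n n] nonneg_upto_distinct_gf] y
    by simp
  moreover have "0 \<notin> A"
    using zero_notin_doubling_chain[of 1 a] zero_notin_doubling_chain[of 3 n]
      zero_notin_doubling_chain[of y n] y assms by (auto simp: A_def)
  ultimately have "int (part_count m n) - int (part_count (Suc m) n) \<ge> 0"
    by (subst part_count_diff[of A]) (auto simp: A_def nonneg_upto_def)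
  then show ?thesis by simp
qed

text \<open>The factor \<open>1 - X + X ^ (M + 1)\<close>, which agrees with \<open>1 - X\<close> up to degree \<open>M\<close>, is chosen such
  that \<open>(1 - X + X ^ (M + 2)) * (1 + X ^ (M + 1)) = (1 - X + X ^ (M + 1)) + X ^ (2 * M + 3)\<close>; this
  corresponds to increasing the largest part of a partition by one.\<close>

lemma distinct_gf_telescope:
  assumes "0 < m" "Suc m \<le> M"
  shows "fps_nth ((1 - fps_X + fps_X ^ (m + 2)) * distinct_gf {1..<m}) i
       \<le> fps_nth ((1 - fps_X + fps_X ^ Suc M) * distinct_gf ({1..M} - {m, Suc m})) i"
  using assms(2)
proof (induction M rule: dec_induct)
  case base
  have "{1..Suc m} - {m, Suc m} = {1..<m}" by auto
  then show ?case by simp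
next
  case (step M)
  let ?G = "distinct_gf ({1..M} - {m, Suc m})"
  have "{1..Suc M} - {m, Suc m} = insert (Suc M) ({1..M} - {m, Suc m})"
    using step.hyps by auto
  then have "(1 - fps_X + fps_X ^ Suc (Suc M)) * distinct_gf ({1..Suc M} - {m, Suc m}) =
      (1 - fps_X + fps_X ^ Suc (Suc M)) * (1 + fps_X ^ Suc M) * ?G"
    by (simp add: distinct_gf_insert mult.assoc)
  also have "\<dots> = (1 - fps_X + fps_X ^ Suc M) * ?G + fps_X ^ (2 * M + 3) * ?G"
    by (simp add: algebra_simps power_add power_mult power2_eq_square power3_eq_cube)
  finally have "fps_nth ((1 - fps_X + fps_X ^ Suc (Suc M)) * distinct_gf ({1..Suc M} - {m, Suc m})) i
      = fps_nth ((1 - fps_X + fps_X ^ Suc M) * ?G) i + fps_nth (fps_X ^ (2 * M + 3) * ?G) i"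
    by simp
  moreover have "fps_nth (fps_X ^ (2 * M + 3) * ?G) i \<ge> 0"
    using nonneg_upto_mult[OF nonneg_upto_X_power nonneg_upto_distinct_gf]
    by (auto simp: nonneg_upto_def)
  ultimately show ?case using step.IH by linarith
qed

lemma part_count_Suc_le_small:
  assumes "8 < n" "0 < m" "m \<le> 4"
  shows "part_count (Suc m) n \<le> part_count m n"
proof -
  let ?G = "distinct_gf ({1..n} - {m, Suc m})"
  have "m = 1 \<or> m = 2 \<or> m = 3 \<or> m = 4" using assms by auto
  \<comment> \<open>For \<open>m\<close> = 1, 2, 3, 4 the only negative coefficient has degree 1, 2,
    4, 4, which corresponds to \<open>n\<close> = 2, 4, 7, 8. The last case is the source of the
    bound \<open>8 < n\<close>.\<close>
  then have "fps_nth ((1 - fps_X + fps_X ^ (m + 2)) * distinct_gf {1..<m}) (n - m) \<ge> 0"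
  proof (elim disjE)
    assume m: "m = 1"
    show ?thesis using assms(1) by (simp add: m distinct_gf_def)
  next
    assume m: "m = 2"
    have "{1..<2} = {1::nat}" by auto
    then have "(1 - fps_X + fps_X ^ (m + 2)) * distinct_gf {1..<m} =
        1 - fps_X ^ 2 + fps_X ^ 4 + fps_X ^ 5"
      by (simp add: m distinct_gf_def algebra_simps eval_nat_numeral)
    then show ?thesis using assms(1) by (simp add: m)
  next
    assume m: "m = 3"
    have "{1..<3} = {1::nat, 2}" by auto
    then have "(1 - fps_X + fps_X ^ (m + 2)) * distinct_gf {1..<m} =
        1 - fps_X ^ 4 + fps_X ^ 5 + fps_X ^ 6 + fps_X ^ 7 + fps_X ^ 8"
      by (simp add: m distinct_gf_def algebra_simps eval_nat_numeral)
    then show ?thesis using assms(1) by (simp add: m)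
  next
    assume m: "m = 4"
    have "{1..<4} = {1::nat, 2, 3}" by auto
    then have "(1 - fps_X + fps_X ^ (m + 2)) * distinct_gf {1..<m} =
        1 + fps_X ^ 3 - fps_X ^ 4 + fps_X ^ 6 + fps_X ^ 8 + fps_X ^ 9 + fps_X ^ 9
        + fps_X ^ 10 + fps_X ^ 11 + fps_X ^ 12"
      by (simp add: m distinct_gf_def algebra_simps eval_nat_numeral)
    then show ?thesis using assms(1) by (simp add: m numeral_fps_const)
  qed
  also have "\<dots> \<le> fps_nth ((1 - fps_X + fps_X ^ Suc n) * ?G) (n - m)"
    using assms by (intro distinct_gf_telescope) auto
  also have "\<dots> = fps_nth ((1 - fps_X) * ?G + fps_X ^ Suc n * ?G) (n - m)"
    by (simp only: distrib_right)
  \<comment> \<open>The correction term starts only in degree \<open>n + 1\<close>.\<close>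
  also have "\<dots> = fps_nth ((1 - fps_X) * ?G) (n - m)"
    by (simp add: fps_X_power_mult_nth del: power_Suc)
  finally have "int (part_count m n) - int (part_count (Suc m) n) \<ge> 0"
    using assms by (subst part_count_diff[of "{1..n}"]) auto
  then show ?thesis by simp
qed

lemma part_count_Suc_le:
  assumes "8 < n" "0 < m"
  shows "part_count (Suc m) n \<le> part_count m n"
proof (cases "m \<le> 4")
  case False
  show ?thesis
  proof (cases "\<exists>a. m = 2 ^ a \<or> Suc m = 2 ^ a")
    case True
    then obtain a where a: "m = 2 ^ a \<or> Suc m = 2 ^ a" by blast
    then have "(2::nat) ^ 2 < 2 ^ a" using False by auto
    then have "2 < a" by (simp only: power_strict_increasing_iff)
    then have "(2::nat) ^ 3 \<le> 2 ^ a" by (intro power_increasing) auto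
    then show ?thesis using a by (intro part_count_Suc_le_power2) auto
  qed (use assms in \<open>auto intro: part_count_Suc_le_not_power2\<close>)
qed (use assms in \<open>auto intro: part_count_Suc_le_small\<close>)

lemma part_count_antimono:
  assumes "8 < n" "0 < m" "m \<le> m'"
  shows "part_count m' n \<le> part_count m n"
  using assms(3)
proof (induction m' rule: dec_induct)
  case (step k)
  then show ?case using part_count_Suc_le[of n k] assms by linarith
qed simp

section \<open>From part counts to \<open>D\<close>\<close>

lemma bij_betw_set_distinct_partitions:
  "bij_betw set (distinct_partitions n) {S. finite S \<and> 0 \<notin> S \<and> \<Sum>S = n}"
proof (rule bij_betwI[where g = "\<lambda>S. rev (sorted_list_of_set S)"])
  show "set \<in> distinct_partitions n \<rightarrow> {S. finite S \<and> 0 \<notin> S \<and> \<Sum>S = n}"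
    by (auto simp: distinct_partitions_def partitions_def distinct_sum_list_conv_Sum)
  show "(\<lambda>S. rev (sorted_list_of_set S)) \<in> {S. finite S \<and> 0 \<notin> S \<and> \<Sum>S = n} \<rightarrow> distinct_partitions n"
    by (auto simp: distinct_partitions_def partitions_def distinct_sum_list_conv_Sum
        sorted_wrt_rev intro: gr0I)
  show "rev (sorted_list_of_set (set ps)) = ps" if "ps \<in> distinct_partitions n" for ps
  proof -
    have "sorted (rev ps)" "distinct ps"
      using that by (auto simp: distinct_partitions_def partitions_def sorted_wrt_rev)
    then have "sorted_list_of_set (set ps) = rev ps"
      by (metis distinct_rev set_rev sorted_list_of_set.idem_if_sorted_distinct)
    then show ?thesis by simp
  qed
qed auto

text \<open>Double counting of pairs of a partition and a part of it in the residue class. Indices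
  beyond \<open>n\<close> would give parts larger than \<open>n\<close>, so \<open>k \<le> n\<close>
  misses nothing.\<close>

lemma D_eq_sum_part_count:
  assumes "1 \<le> r" "r \<le> t"
  shows "D r t n = (\<Sum>k\<le>n. part_count (r + k * t) n)"
proof -
  let ?F = "{S. finite S \<and> 0 \<notin> S \<and> \<Sum>S = n}"
  have fin: "finite ?F"
    using bij_betw_finite[OF bij_betw_set_distinct_partitions] finite_distinct_partitions by blast
  have "D r t n = (\<Sum>S\<in>?F. card {p \<in> S. [p = r] (mod t)})"
    unfolding D_def by (rule sum.reindex_bij_betw[OF bij_betw_set_distinct_partitions])
  also have "\<dots> = (\<Sum>S\<in>?F. \<Sum>k\<le>n. if r + k * t \<in> S then 1 else 0)"
  proof (rule sum.cong)
    fix S assume S: "S \<in> ?F"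
    have inj: "inj_on (\<lambda>k. r + k * t) K" for K
      using assms by (auto simp: inj_on_def)
    have "{p \<in> S. [p = r] (mod t)} = (\<lambda>k. r + k * t) ` {k. k \<le> n \<and> r + k * t \<in> S}"
    proof (intro subset_antisym subsetI)
      fix p assume p: "p \<in> {p \<in> S. [p = r] (mod t)}"
      then have pn: "p \<le> n" "p \<noteq> 0"
        using S member_le_sum[of p S "\<lambda>x. x"] by (auto intro: gr0I)
      \<comment> \<open>If \<open>r < t\<close>, a smaller \<open>p\<close> would be its own
        residue, different from \<open>r\<close>; if \<open>r = t\<close>, it would have to be 0,
        which is not a part.\<close>
      have "r \<le> p"
      proof (rule ccontr)
        assume "\<not> r \<le> p"
        then show False
          using p pn assms by (cases "r = t") (auto simp: cong_def)
      qed
      then have "t dvd p - r" using p by (simp add: cong_altdef_nat)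
      then obtain k where "p - r = t * k" by blast
      then have k: "p = r + k * t" using \<open>r \<le> p\<close> by (simp add: mult.commute)
      have "k \<le> k * t" using assms by simp
      then have "k \<le> n" using k pn by linarith
      then show "p \<in> (\<lambda>k. r + k * t) ` {k. k \<le> n \<and> r + k * t \<in> S}"
        using k p by blast
    qed (auto simp: cong_def)
    then show "card {p \<in> S. [p = r] (mod t)} = (\<Sum>k\<le>n. if r + k * t \<in> S then 1 else 0)"
      by (simp add: card_image[OF inj] sum.If_cases Int_def)
  qed simp
  also have "\<dots> = (\<Sum>k\<le>n. \<Sum>S\<in>?F. if r + k * t \<in> S then 1 else 0)"
    by (rule sum.swap)
  also have "\<dots> = (\<Sum>k\<le>n. part_count (r + k * t) n)"
    using fin by (simp add: sum.If_cases part_count_def Int_def conj_assoc)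
  finally show ?thesis .
qed

lemma D_mono:
  assumes "8 < n" "1 \<le> r" "r < s" "s \<le> t"
  shows "D s t n \<le> D r t n"
  using assms by (auto simp: D_eq_sum_part_count intro!: sum_mono part_count_antimono)

theorem corollary1p3:
  shows "(\<forall>r s t :: nat. 1 \<le> r \<and> r < s \<and> s \<le> t \<longrightarrow>
            (\<forall>\<^sub>F n in sequentially. D r t n \<ge> D s t n)) \<and>
         (\<forall>t r s n :: nat. 2 \<le> t \<and> t \<le> 10 \<and> 1 \<le> r \<and> r < s \<and> s \<le> t \<and> n > 8 \<longrightarrow>
            D r t n \<ge> D s t n)"
proof (intro conjI allI impI)
  fix r s t :: nat
  assume "1 \<le> r \<and> r < s \<and> s \<le> t"
  then show "\<forall>\<^sub>F n in sequentially. D r t n \<ge> D s t n"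
    \<comment> \<open>The threshold 8 is uniform in \<open>r\<close>, \<open>s\<close> and
      \<open>t\<close>.\<close>
    by (intro eventually_mono[OF eventually_gt_at_top[of 8]]) (simp add: D_mono)
qed (simp add: D_mono)

end
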